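(* Let $g\in H(\mathbb{D})$ be such that the integral operator $S_g$ is bounded on the Dirichlet space $\mathcal{D}$. Then its operator norm on $\mathcal{D}$ is $$\|S_g\|=\sup_{z\in\mathbb{D}}|g(z)|.$$
   Context: $\mathbb{D}$ is the open unit disc in $\mathbb{C}$ and $H(\mathbb{D})$ is the space of analytic functions on $\mathbb{D}$. For $g\in H(\mathbb{D})$, the operator $S_g$ is defined on $H(\mathbb{D})$ by $S_gf(z)=\int_0^z f'(w)g(w)\,dw$. Let $dA(z)=\frac1\pi\,dx\,dy$. The Dirichlet space $\mathcal{D}$ is the space of all $f\in H(\mathbb{D})$ with $\int_{\mathbb{D}}|f'(z)|^2\,dA(z)<\infty$, with norm $\|f\|_{\mathcal{D}}=\big(|f(0)|^2+\int_{\mathbb{D}}|f'(z)|^2\,dA(z)\big)^{1/2}$. *)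

theory Defs
  imports "HOL-Complex_Analysis.Complex_Analysis"
begin

text \<open>
  Analytic functions on the open unit disc are represented by total functions
  \<^typ>\<open>complex \<Rightarrow> complex\<close> that are holomorphic on the disc. All notions below depend
  only on the values inside the disc.
\<close>

abbreviation unit_disc :: "complex set" where
  "unit_disc \<equiv> ball 0 1"

definition area_measure :: "complex measure" where
  "area_measure = density lborel (\<lambda>_. ennreal (1 / pi))"

definition dirichlet_space :: "(complex \<Rightarrow> complex) set" where
  "dirichlet_space =
    {f. f holomorphic_on unit_disc \<and>
        set_integrable area_measure unit_disc (\<lambda>z. (cmod (deriv f z))\<^sup>2)}"

definition dirichlet_norm :: "(complex \<Rightarrow> complex) \<Rightarrow> real" where
  "dirichlet_norm f =
    sqrt ((cmod (f 0))\<^sup>2 + (LINT z:unit_disc|area_measure. (cmod (deriv f z))\<^sup>2))"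

definition S_op :: "(complex \<Rightarrow> complex) \<Rightarrow> (complex \<Rightarrow> complex) \<Rightarrow> complex \<Rightarrow> complex" where
  "S_op g f z = contour_integral (linepath 0 z) (\<lambda>w. deriv f w * g w)"

definition bounded_on_dirichlet ::
    "((complex \<Rightarrow> complex) \<Rightarrow> (complex \<Rightarrow> complex)) \<Rightarrow> bool" where
  "bounded_on_dirichlet T \<longleftrightarrow>
    (\<forall>f\<in>dirichlet_space. T f \<in> dirichlet_space) \<and>
    (\<exists>C. \<forall>f\<in>dirichlet_space. dirichlet_norm (T f) \<le> C * dirichlet_norm f)"

text \<open>
  The supremum is taken in the reals, so the following is meaningful only for operators
  satisfying \<^const>\<open>bounded_on_dirichlet\<close>.
\<close>

definition dirichlet_opnorm ::
    "((complex \<Rightarrow> complex) \<Rightarrow> (complex \<Rightarrow> complex)) \<Rightarrow> real" where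
  "dirichlet_opnorm T =
    (SUP f\<in>{f \<in> dirichlet_space. dirichlet_norm f \<le> 1}. dirichlet_norm (T f))"

end

theory Submission
  imports Defs
begin

text \<open>
  Since \<open>(S\<^sub>g f)' = f' g\<close> and \<open>S\<^sub>g f (0) = 0\<close>, the operator \<open>S\<^sub>g\<close> acts on derivatives as
  multiplication by \<open>g\<close> on the Bergman space. The upper bound \<open>\<parallel>S\<^sub>g\<parallel> \<le> sup \<bar>g\<bar>\<close> is
  therefore immediate (\<open>dirichlet_norm_S_op_le\<close>).

  For the lower bound, write \<open>M = \<parallel>S\<^sub>g\<parallel>\<close> and iterate the operator on the identity function.
  The derivative of \<open>S\<^sub>g\<^sup>n id\<close> is \<open>g\<^sup>n\<close>, so that
  \<open>\<integral> \<bar>g\<bar>\<^bsup>2n\<^esup> dA \<le> \<parallel>S\<^sub>g\<^sup>n id\<parallel>\<^sup>2 \<le> M\<^bsup>2n\<^esup> \<parallel>id\<parallel>\<^sup>2\<close> for all \<open>n\<close>. If \<open>\<bar>g(z)\<bar> > M\<close> for some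
  \<open>z\<close>, then \<open>\<bar>g\<bar> > r > M\<close> on a small disc of some area \<open>\<delta> > 0\<close>, and
  \<open>\<delta> r\<^bsup>2n\<^esup> \<le> M\<^bsup>2n\<^esup> \<parallel>id\<parallel>\<^sup>2\<close> for all \<open>n\<close>, which is absurd since \<open>r > M\<close>.
  In particular \<open>g\<close> is bounded on the disc, so its supremum is finite and the upper bound
  can be applied with a real constant.
\<close>

section \<open>Area measure\<close>

lemma sets_area_measure [simp, measurable_cong]: "sets area_measure = sets borel"
  by (simp add: area_measure_def)

lemma space_area_measure [simp]: "space area_measure = UNIV"
  by (simp add: area_measure_def)

lemma emeasure_area_measure:
  assumes "A \<in> sets borel"
  shows "emeasure area_measure A = ennreal (1 / pi) * emeasure lborel A"
  using assms by (simp add: area_measure_def emeasure_density nn_integral_cmult_indicator)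

lemma emeasure_area_measure_ball_finite: "emeasure area_measure (ball z r) < \<infinity>"
  using emeasure_bounded_finite[OF bounded_ball, of z r]
  by (simp add: emeasure_area_measure ennreal_mult_less_top)

lemma measure_area_measure_ball_pos:
  assumes "r > 0"
  shows "measure area_measure (ball z r) > 0"
proof -
  have "measure area_measure (ball z r) = (1 / pi) * measure lborel (ball z r)"
    by (simp add: measure_def emeasure_area_measure enn2real_mult)
  then show ?thesis
    using assms content_ball_pos[of r z] by (simp add: measure_completion)
qed

section \<open>The Dirichlet norm\<close>

lemma deriv_cong_unit_disc:
  assumes "\<And>z. z \<in> unit_disc \<Longrightarrow> f z = h z" "z \<in> unit_disc"
  shows "deriv f z = deriv h z"
proof (rule deriv_cong_ev)
  show "\<forall>\<^sub>F w in nhds z. f w = h w"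
    using eventually_nhds_in_open[OF open_ball assms(2)] assms(1)
    by (auto elim: eventually_mono)
qed simp

lemma dirichlet_norm_nonneg: "dirichlet_norm f \<ge> 0"
  by (simp add: dirichlet_norm_def set_lebesgue_integral_def)

lemma dirichlet_integral_nonneg:
  "(LINT z:unit_disc|area_measure. (cmod (deriv f z))\<^sup>2) \<ge> 0"
  by (simp add: set_lebesgue_integral_def)

lemma dirichlet_norm_cong:
  assumes "\<And>z. z \<in> unit_disc \<Longrightarrow> f z = h z"
  shows "dirichlet_norm f = dirichlet_norm h"
proof -
  have "(LINT z:unit_disc|area_measure. (cmod (deriv f z))\<^sup>2)
      = (LINT z:unit_disc|area_measure. (cmod (deriv h z))\<^sup>2)"
    by (rule set_lebesgue_integral_cong) (use deriv_cong_unit_disc[OF assms] in auto)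
  with assms[of 0] show ?thesis by (simp add: dirichlet_norm_def)
qed

lemma deriv_cmult_unit_disc:
  assumes "f holomorphic_on unit_disc" "z \<in> unit_disc"
  shows "deriv (\<lambda>z. c * f z) z = c * deriv f z"
  using assms by (intro deriv_cmult) (auto simp: holomorphic_on_open field_differentiable_def)

lemma dirichlet_space_cmult:
  assumes "f \<in> dirichlet_space"
  shows "(\<lambda>z. c * f z) \<in> dirichlet_space"
    and "dirichlet_norm (\<lambda>z. c * f z) = cmod c * dirichlet_norm f"
proof -
  have hol: "f holomorphic_on unit_disc"
    and int: "set_integrable area_measure unit_disc (\<lambda>z. (cmod (deriv f z))\<^sup>2)"
    using assms by (auto simp: dirichlet_space_def)
  have eq: "(cmod (deriv (\<lambda>z. c * f z) z))\<^sup>2 = (cmod c)\<^sup>2 * (cmod (deriv f z))\<^sup>2"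
    if "z \<in> unit_disc" for z
    using deriv_cmult_unit_disc[OF hol that] by (simp add: norm_mult power_mult_distrib)
  have "set_integrable area_measure unit_disc (\<lambda>z. (cmod c)\<^sup>2 * (cmod (deriv f z))\<^sup>2)"
    using int by simp
  then have "set_integrable area_measure unit_disc (\<lambda>z. (cmod (deriv (\<lambda>z. c * f z) z))\<^sup>2)"
    using eq by (subst set_integrable_cong[OF refl refl]) auto
  with hol show "(\<lambda>z. c * f z) \<in> dirichlet_space"
    by (auto simp: dirichlet_space_def intro!: holomorphic_intros)
  have "(LINT z:unit_disc|area_measure. (cmod (deriv (\<lambda>z. c * f z) z))\<^sup>2)
      = (LINT z:unit_disc|area_measure. (cmod c)\<^sup>2 * (cmod (deriv f z))\<^sup>2)"
    by (rule set_lebesgue_integral_cong) (use eq in auto)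
  then have "dirichlet_norm (\<lambda>z. c * f z) = sqrt ((cmod c)\<^sup>2 * ((cmod (f 0))\<^sup>2 +
      (LINT z:unit_disc|area_measure. (cmod (deriv f z))\<^sup>2)))"
    by (simp add: dirichlet_norm_def norm_mult power_mult_distrib distrib_left)
  then show "dirichlet_norm (\<lambda>z. c * f z) = cmod c * dirichlet_norm f"
    by (simp add: dirichlet_norm_def real_sqrt_mult)
qed

section \<open>Derivative and linearity of the integral operator\<close>

lemma S_op_at_0 [simp]: "S_op g f 0 = 0"
  by (simp add: S_op_def)

lemma deriv_S_op:
  assumes "g holomorphic_on unit_disc" "f holomorphic_on unit_disc" "z \<in> unit_disc"
  shows "deriv (S_op g f) z = deriv f z * g z"
proof -
  have "(\<lambda>w. deriv f w * g w) holomorphic_on unit_disc"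
    using assms by (intro holomorphic_intros) auto
  then obtain F where F: "\<And>w. w \<in> unit_disc \<Longrightarrow>
      (F has_field_derivative deriv f w * g w) (at w within unit_disc)"
    using holomorphic_convex_primitive'[of unit_disc "\<lambda>w. deriv f w * g w"]
    by (metis convex_ball open_ball)
  have "S_op g f w = F w - F 0" if "w \<in> unit_disc" for w
  proof -
    have "closed_segment 0 w \<subseteq> unit_disc"
      using that by (intro closed_segment_subset) auto
    then have "((\<lambda>w. deriv f w * g w) has_contour_integral F w - F 0) (linepath 0 w)"
      using contour_integral_primitive[OF F, where g = "linepath 0 w"] by simp
    then show ?thesis
      unfolding S_op_def by (rule contour_integral_unique)
  qed
  then have "deriv (S_op g f) z = deriv (\<lambda>w. F w - F 0) z"
    by (rule deriv_cong_unit_disc) (use assms(3) in auto)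
  also have "\<dots> = deriv f z * g z"
  proof (rule DERIV_imp_deriv)
    have "(F has_field_derivative deriv f z * g z) (at z)"
      using F[OF assms(3)] at_within_open[OF assms(3) open_ball] by simp
    then show "((\<lambda>w. F w - F 0) has_field_derivative deriv f z * g z) (at z)"
      using DERIV_diff[OF _ DERIV_const] by fastforce
  qed
  finally show ?thesis .
qed

text \<open>
  Homogeneity is claimed only inside the disc: outside it the values of \<^const>\<open>S_op\<close> carry
  no meaning.
\<close>

lemma S_op_cmult:
  assumes "f holomorphic_on unit_disc" "z \<in> unit_disc"
    and "g holomorphic_on unit_disc"
  shows "S_op g (\<lambda>w. c * f w) z = c * S_op g f z"
proof -
  have seg: "closed_segment 0 z \<subseteq> unit_disc"
    using assms(2) by (intro closed_segment_subset) auto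
  have "continuous_on unit_disc (\<lambda>w. deriv f w * g w)"
    using assms by (intro holomorphic_on_imp_continuous_on holomorphic_intros) auto
  then have int: "(\<lambda>w. deriv f w * g w) contour_integrable_on linepath 0 z"
    using seg by (intro contour_integrable_continuous_linepath) (rule continuous_on_subset)
  have "S_op g (\<lambda>w. c * f w) z
      = contour_integral (linepath 0 z) (\<lambda>w. c * (deriv f w * g w))"
    unfolding S_op_def
    by (rule contour_integral_cong)
       (use seg deriv_cmult_unit_disc[OF assms(1)] in \<open>auto simp: mult.assoc\<close>)
  also have "\<dots> = c * S_op g f z"
    unfolding S_op_def by (rule contour_integral_lmul[OF int])
  finally show ?thesis .
qed

section \<open>Operator norms\<close>

lemma dirichlet_norm_S_op_le:
  assumes "g holomorphic_on unit_disc" "f \<in> dirichlet_space" "S_op g f \<in> dirichlet_space"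
    and M: "\<And>z. z \<in> unit_disc \<Longrightarrow> cmod (g z) \<le> M"
  shows "dirichlet_norm (S_op g f) \<le> M * dirichlet_norm f"
proof -
  have M0: "M \<ge> 0" using M[of 0] by (simp add: order_trans[OF norm_ge_zero])
  have hol: "f holomorphic_on unit_disc"
    and int: "set_integrable area_measure unit_disc (\<lambda>z. (cmod (deriv f z))\<^sup>2)"
    and int': "set_integrable area_measure unit_disc (\<lambda>z. (cmod (deriv (S_op g f) z))\<^sup>2)"
    using assms by (auto simp: dirichlet_space_def)
  let ?I = "LINT z:unit_disc|area_measure. (cmod (deriv f z))\<^sup>2"
  have "(LINT z:unit_disc|area_measure. (cmod (deriv (S_op g f) z))\<^sup>2)
      \<le> (LINT z:unit_disc|area_measure. M\<^sup>2 * (cmod (deriv f z))\<^sup>2)"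
  proof (rule set_integral_mono[OF int'])
    show "set_integrable area_measure unit_disc (\<lambda>z. M\<^sup>2 * (cmod (deriv f z))\<^sup>2)"
      using int by simp
    fix z :: complex assume z: "z \<in> unit_disc"
    have "cmod (deriv (S_op g f) z) \<le> M * cmod (deriv f z)"
      using mult_right_mono[OF M[OF z] norm_ge_zero[of "deriv f z"]]
        deriv_S_op[OF assms(1) hol z]
      by (simp add: norm_mult mult.commute)
    then show "(cmod (deriv (S_op g f) z))\<^sup>2 \<le> M\<^sup>2 * (cmod (deriv f z))\<^sup>2"
      by (metis norm_ge_zero power_mono power_mult_distrib)
  qed
  also have "\<dots> = M\<^sup>2 * ?I" by simp
  also have "\<dots> \<le> M\<^sup>2 * ((cmod (f 0))\<^sup>2 + ?I)"
    by (intro mult_left_mono) auto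
  finally have "dirichlet_norm (S_op g f) \<le> sqrt (M\<^sup>2 * ((cmod (f 0))\<^sup>2 + ?I))"
    by (simp add: dirichlet_norm_def)
  then show ?thesis
    using M0 by (simp add: dirichlet_norm_def real_sqrt_mult)
qed

text \<open>
  Boundedness of the operator makes the real supremum in \<^const>\<open>dirichlet_opnorm\<close> a genuine
  least upper bound.
\<close>

lemma bdd_above_S_op_unit_ball:
  assumes "bounded_on_dirichlet T"
  shows "bdd_above ((\<lambda>f. dirichlet_norm (T f)) ` {f \<in> dirichlet_space. dirichlet_norm f \<le> 1})"
proof -
  obtain C where C: "\<And>f. f \<in> dirichlet_space \<Longrightarrow> dirichlet_norm (T f) \<le> C * dirichlet_norm f"
    using assms by (auto simp: bounded_on_dirichlet_def)
  have "dirichlet_norm (T f) \<le> \<bar>C\<bar>" if "f \<in> dirichlet_space" "dirichlet_norm f \<le> 1" for f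
  proof -
    have "C * dirichlet_norm f \<le> \<bar>C\<bar> * 1"
      using that dirichlet_norm_nonneg[of f] by (intro mult_mono) auto
    with C[OF that(1)] show ?thesis by simp
  qed
  then show ?thesis by (auto intro!: bdd_aboveI2)
qed

lemma zero_in_dirichlet_space: "(\<lambda>_. 0) \<in> dirichlet_space"
  and dirichlet_norm_zero: "dirichlet_norm (\<lambda>_. 0) = 0"
  by (auto simp: dirichlet_space_def dirichlet_norm_def set_integrable_def)

lemma dirichlet_opnorm_nonneg:
  assumes "bounded_on_dirichlet T"
  shows "dirichlet_opnorm T \<ge> 0"
  unfolding dirichlet_opnorm_def
  by (rule cSUP_upper2[OF bdd_above_S_op_unit_ball[OF assms], where x = "\<lambda>_. 0"])
     (auto simp: zero_in_dirichlet_space dirichlet_norm_zero dirichlet_norm_nonneg)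

lemma dirichlet_norm_S_op_le_opnorm:
  assumes "g holomorphic_on unit_disc" "bounded_on_dirichlet (S_op g)" "f \<in> dirichlet_space"
  shows "dirichlet_norm (S_op g f) \<le> dirichlet_opnorm (S_op g) * dirichlet_norm f"
proof (cases "dirichlet_norm f = 0")
  case True
  \<comment> \<open>Here \<open>f\<close> cannot be normalised; any bound for the operator gives \<open>S\<^sub>g f\<close> norm 0.\<close>
  obtain C where "dirichlet_norm (S_op g f) \<le> C * dirichlet_norm f"
    using assms by (auto simp: bounded_on_dirichlet_def)
  with True show ?thesis by simp
next
  case False
  define N where "N = dirichlet_norm f"
  have N: "N > 0" using False dirichlet_norm_nonneg[of f] by (simp add: N_def)
  define h where "h = (\<lambda>z. complex_of_real (1 / N) * f z)"
  have hol: "f holomorphic_on unit_disc"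
    using assms by (auto simp: dirichlet_space_def)
  have h: "h \<in> dirichlet_space" "dirichlet_norm h = 1"
    using dirichlet_space_cmult[OF assms(3), of "complex_of_real (1 / N)"] N
    by (auto simp: h_def norm_divide simp flip: N_def)
  \<comment> \<open>The two functions may differ outside the disc, but the norm does not see this.\<close>
  have "dirichlet_norm (S_op g h) = dirichlet_norm (\<lambda>z. complex_of_real (1 / N) * S_op g f z)"
    unfolding h_def by (intro dirichlet_norm_cong S_op_cmult assms hol)
  also have "\<dots> = dirichlet_norm (S_op g f) / N"
    using assms(2,3) N
    by (subst dirichlet_space_cmult(2)) (auto simp: bounded_on_dirichlet_def norm_divide)
  finally have "dirichlet_norm (S_op g f) / N \<le> dirichlet_opnorm (S_op g)"
    using cSUP_upper[OF _ bdd_above_S_op_unit_ball[OF assms(2)], of h] h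
    by (simp add: dirichlet_opnorm_def)
  with N show ?thesis by (simp add: N_def field_simps)
qed

section \<open>Iterating on the identity function\<close>

lemma deriv_funpow_S_op:
  assumes "g holomorphic_on unit_disc" "bounded_on_dirichlet (S_op g)"
  shows "(S_op g ^^ n) (\<lambda>z. z) \<in> dirichlet_space"
    and "\<And>z. z \<in> unit_disc \<Longrightarrow> deriv ((S_op g ^^ n) (\<lambda>z. z)) z = g z ^ n"
    and "dirichlet_norm ((S_op g ^^ n) (\<lambda>z. z))
      \<le> dirichlet_opnorm (S_op g) ^ n * dirichlet_norm (\<lambda>z. z)"
proof (induction n)
  case 0
  have "integrable area_measure (indicator unit_disc :: complex \<Rightarrow> real)"
    using emeasure_area_measure_ball_finite[of 0 1] by (intro integrable_real_indicator) auto
  then show "(S_op g ^^ 0) (\<lambda>z. z) \<in> dirichlet_space"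
    by (simp add: dirichlet_space_def set_integrable_def)
  show "deriv ((S_op g ^^ 0) (\<lambda>z. z)) z = g z ^ 0" for z
    by simp
  show "dirichlet_norm ((S_op g ^^ 0) (\<lambda>z. z))
      \<le> dirichlet_opnorm (S_op g) ^ 0 * dirichlet_norm (\<lambda>z. z)"
    by simp
next
  case (Suc n)
  let ?f = "(S_op g ^^ n) (\<lambda>z. z)" and ?M = "dirichlet_opnorm (S_op g)"
  show "(S_op g ^^ Suc n) (\<lambda>z. z) \<in> dirichlet_space"
    using Suc.IH(1) assms(2) by (simp add: bounded_on_dirichlet_def)
  show "deriv ((S_op g ^^ Suc n) (\<lambda>z. z)) z = g z ^ Suc n" if "z \<in> unit_disc" for z
    using deriv_S_op[OF assms(1) _ that, of ?f] Suc.IH(1) Suc.IH(2)[OF that]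
    by (simp add: dirichlet_space_def mult.commute)
  have "dirichlet_norm (S_op g ?f) \<le> ?M * dirichlet_norm ?f"
    by (rule dirichlet_norm_S_op_le_opnorm[OF assms Suc.IH(1)])
  also have "\<dots> \<le> ?M * (?M ^ n * dirichlet_norm (\<lambda>z. z))"
    using Suc.IH(3) dirichlet_opnorm_nonneg[OF assms(2)] by (rule mult_left_mono)
  finally show "dirichlet_norm ((S_op g ^^ Suc n) (\<lambda>z. z))
      \<le> ?M ^ Suc n * dirichlet_norm (\<lambda>z. z)"
    by (simp add: mult.assoc)
qed

text \<open>
  The lower bound for the operator norm: comparing the growth in \<open>n\<close> of \<open>\<integral> \<bar>g\<bar>\<^bsup>2n\<^esup> dA\<close> with
  that of the norms of the iterates.
\<close>

lemma cmod_le_dirichlet_opnorm_S_op: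
  assumes "g holomorphic_on unit_disc" "bounded_on_dirichlet (S_op g)" "z \<in> unit_disc"
  shows "cmod (g z) \<le> dirichlet_opnorm (S_op g)"
proof (rule ccontr)
  define M where "M = dirichlet_opnorm (S_op g)"
  assume "\<not> cmod (g z) \<le> dirichlet_opnorm (S_op g)"
  then obtain r where r: "M < r" "r < cmod (g z)"
    using dense[of M "cmod (g z)"] by (auto simp: M_def not_le)
  have M0: "M \<ge> 0" unfolding M_def by (rule dirichlet_opnorm_nonneg[OF assms(2)])
  let ?U = "{w \<in> unit_disc. r < cmod (g w)}"
  have "open ?U"
  proof -
    have "continuous_on unit_disc (\<lambda>w. cmod (g w))"
      using holomorphic_on_imp_continuous_on[OF assms(1)] by (rule continuous_on_norm)
    then have "open (unit_disc \<inter> (\<lambda>w. cmod (g w)) -` {r<..})"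
      by (rule continuous_open_preimage) auto
    also have "unit_disc \<inter> (\<lambda>w. cmod (g w)) -` {r<..} = ?U"
      by auto
    finally show ?thesis .
  qed
  then obtain e where e: "e > 0" "ball z e \<subseteq> ?U"
    using r assms(3) by (metis (mono_tags, lifting) mem_Collect_eq open_contains_ball)
  define \<delta> where "\<delta> = measure area_measure (ball z e)"
  have \<delta>: "\<delta> > 0" unfolding \<delta>_def by (rule measure_area_measure_ball_pos[OF e(1)])
  define K where "K = (dirichlet_norm (\<lambda>z. z))\<^sup>2"
  have bound: "\<delta> * (r\<^sup>2) ^ n \<le> (M\<^sup>2) ^ n * K" for n
  proof -
    let ?f = "(S_op g ^^ n) (\<lambda>z. z)"
    let ?I = "LINT w:unit_disc|area_measure. (cmod (deriv ?f w))\<^sup>2"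
    have int: "set_integrable area_measure unit_disc (\<lambda>w. (cmod (deriv ?f w))\<^sup>2)"
      using deriv_funpow_S_op(1)[OF assms(1,2), of n] by (simp add: dirichlet_space_def)
    have "\<delta> * (r\<^sup>2) ^ n = (LINT w|area_measure. indicator (ball z e) w *\<^sub>R (r\<^sup>2) ^ n)"
      by (simp add: \<delta>_def)
    also have "\<dots> \<le> ?I"
      unfolding set_lebesgue_integral_def
    proof (rule integral_mono)
      show "integrable area_measure (\<lambda>w. indicator (ball z e) w *\<^sub>R (r\<^sup>2) ^ n)"
        using emeasure_area_measure_ball_finite[of z e] by simp
      show "integrable area_measure (\<lambda>w. indicator unit_disc w *\<^sub>R (cmod (deriv ?f w))\<^sup>2)"
        using int by (simp add: set_integrable_def)
      fix w :: complex
      show "indicator (ball z e) w *\<^sub>R (r\<^sup>2) ^ n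
          \<le> indicator unit_disc w *\<^sub>R (cmod (deriv ?f w))\<^sup>2"
      proof (cases "w \<in> ball z e")
        case True
        then have w: "w \<in> unit_disc" "r < cmod (g w)" using e(2) by auto
        have "r ^ n \<le> cmod (deriv ?f w)"
          using w r M0 deriv_funpow_S_op(2)[OF assms(1,2) w(1), of n]
          by (simp add: norm_power power_mono)
        then have "(r ^ n)\<^sup>2 \<le> (cmod (deriv ?f w))\<^sup>2"
          using r M0 by (intro power_mono) auto
        with True w(1) show ?thesis
          by (simp add: power_mult[symmetric] mult.commute)
      qed auto
    qed
    also have "?I \<le> (dirichlet_norm ?f)\<^sup>2"
      using dirichlet_integral_nonneg[of ?f] by (simp add: dirichlet_norm_def)
    also have "\<dots> \<le> (M ^ n * dirichlet_norm (\<lambda>z. z))\<^sup>2"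
      using deriv_funpow_S_op(3)[OF assms(1,2), of n] dirichlet_norm_nonneg
      by (intro power_mono) (auto simp: M_def)
    also have "\<dots> = (M\<^sup>2) ^ n * K"
      by (simp add: K_def power_mult_distrib power_mult[symmetric] mult.commute)
    finally show ?thesis .
  qed
  define q where "q = M\<^sup>2 / r\<^sup>2"
  have q: "0 \<le> q" "q < 1"
    using r M0 power_strict_mono[of M r 2] by (auto simp: q_def)
  have "\<delta> \<le> q ^ n * K" for n
    using bound[of n] r M0 by (simp add: q_def power_divide field_simps)
  moreover have "(\<lambda>n. q ^ n * K) \<longlonglongrightarrow> 0 * K"
    using q by (intro tendsto_intros LIMSEQ_power_zero) auto
  ultimately have "\<delta> \<le> 0 * K"
    by (intro LIMSEQ_le_const) auto
  with \<delta> show False by simp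
qed

theorem lemma3:
  fixes g :: "complex \<Rightarrow> complex"
  assumes "g holomorphic_on unit_disc"
    and "bounded_on_dirichlet (S_op g)"
  shows "ereal (dirichlet_opnorm (S_op g)) = (SUP z\<in>unit_disc. ereal (cmod (g z)))"
proof (rule antisym)
  have bdd: "bdd_above ((\<lambda>z. cmod (g z)) ` unit_disc)"
    using cmod_le_dirichlet_opnorm_S_op[OF assms] by (rule bdd_aboveI2)
  define M where "M = (SUP z\<in>unit_disc. cmod (g z))"
  have M: "cmod (g z) \<le> M" if "z \<in> unit_disc" for z
    unfolding M_def using that bdd by (rule cSUP_upper)
  have "dirichlet_opnorm (S_op g) \<le> M"
    unfolding dirichlet_opnorm_def
  proof (rule cSUP_least)
    show "{f \<in> dirichlet_space. dirichlet_norm f \<le> 1} \<noteq> {}"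
      using zero_in_dirichlet_space dirichlet_norm_zero by fastforce
    fix f assume f: "f \<in> {f \<in> dirichlet_space. dirichlet_norm f \<le> 1}"
    have "dirichlet_norm (S_op g f) \<le> M * dirichlet_norm f"
      using f assms(2) M
      by (intro dirichlet_norm_S_op_le[OF assms(1)]) (auto simp: bounded_on_dirichlet_def)
    also have "\<dots> \<le> M * 1"
      using f M[of 0] by (intro mult_left_mono) (auto intro: order_trans[OF norm_ge_zero])
    finally show "dirichlet_norm (S_op g f) \<le> M" by simp
  qed
  moreover have "ereal M = (SUP z\<in>unit_disc. ereal (cmod (g z)))"
    unfolding M_def
  proof (rule ereal_SUP)
    obtain B where "\<And>z. z \<in> unit_disc \<Longrightarrow> cmod (g z) \<le> B"
      using M by blast
    then have "(SUP z\<in>unit_disc. ereal (cmod (g z))) \<le> ereal B"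
      by (intro SUP_least) auto
    moreover have "ereal (cmod (g 0)) \<le> (SUP z\<in>unit_disc. ereal (cmod (g z)))"
      by (intro SUP_upper) auto
    ultimately show "\<bar>SUP z\<in>unit_disc. ereal (cmod (g z))\<bar> \<noteq> \<infinity>"
      by auto
  qed
  ultimately show "ereal (dirichlet_opnorm (S_op g)) \<le> (SUP z\<in>unit_disc. ereal (cmod (g z)))"
    by (metis ereal_less_eq(3))
  show "(SUP z\<in>unit_disc. ereal (cmod (g z))) \<le> ereal (dirichlet_opnorm (S_op g))"
    using cmod_le_dirichlet_opnorm_S_op[OF assms] by (intro SUP_least) simp
qed

end
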